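(* Let $L=[l_{ij}]$ be a real $n\times n$ matrix such that every off-diagonal entry of $L$ is non-positive, $L\mathbf{1}=L'\mathbf{1}=0$ and $\operatorname{rank}(L)=n-1$. Let $L^\dagger=[l^\dagger_{ij}]$ be its Moore–Penrose inverse and define $r_{ij}:=l^\dagger_{ii}+l^\dagger_{jj}-2l^\dagger_{ij}$. Then (i) $r_{ij}>0$ for all $i\neq j$; (ii) $r_{ik}\le r_{ij}+r_{jk}$ for all $i,j,k\in\{1,\dots,n\}$.
   Context: $\mathbf{1}$ denotes the all-ones column vector in $\mathbb{R}^n$ and $'$ denotes transpose. *)

theory Defs
  imports "HOL-Analysis.Analysis"
begin

definition is_moore_penrose_inverse :: "real^'n^'m \<Rightarrow> real^'m^'n \<Rightarrow> bool" where
  "is_moore_penrose_inverse A X \<longleftrightarrow>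
     A ** X ** A = A \<and> X ** A ** X = X \<and>
     transpose (A ** X) = A ** X \<and> transpose (X ** A) = X ** A"

text \<open>The definite description below is justified by existence and uniqueness, proved in
  \<open>ex1_moore_penrose_inverse\<close>.\<close>

definition moore_penrose_inverse :: "real^'n^'m \<Rightarrow> real^'m^'n" where
  "moore_penrose_inverse A = (THE X. is_moore_penrose_inverse A X)"

definition resistance :: "real^'n^'n \<Rightarrow> 'n \<Rightarrow> 'n \<Rightarrow> real" where
  "resistance L i j =
     moore_penrose_inverse L $ i $ i + moore_penrose_inverse L $ j $ j
       - 2 * moore_penrose_inverse L $ i $ j"

lemma normal_equation_solvable:
  fixes A :: "real^'n^'m"
  shows "\<exists>x. transpose A *v (A *v x) = transpose A *v y"
proof -
  let ?S = "range (\<lambda>x. A *v x)"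
  have span: "span ?S = ?S"
    by (simp add: linear_subspace_image span_eq_iff)
  obtain u w where u: "u \<in> span ?S" and w: "\<And>v. v \<in> span ?S \<Longrightarrow> orthogonal w v"
    and y: "y = u + w"
    using orthogonal_subspace_decomp_exists by blast
  obtain x where x: "u = A *v x" using u span by auto
  have "inner (transpose A *v w) z = 0" for z
  proof -
    have "inner (transpose A *v w) z = inner w (A *v z)"
      by (metis dot_lmul_matrix transpose_matrix_vector)
    also have "\<dots> = 0" using w[of "A *v z"] span by (auto simp: orthogonal_def)
    finally show ?thesis .
  qed
  hence "transpose A *v w = 0" by (metis inner_eq_zero_iff)
  thus ?thesis using x y by (metis add.right_neutral matrix_vector_right_distrib)
qed

lemma ex_13_inverse:
  fixes A :: "real^'n^'m"
  shows "\<exists>M. A ** M ** A = A \<and> transpose (A ** M) = A ** M"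
proof -
  obtain f where f: "\<And>y. transpose A *v (A *v f y) = transpose A *v y"
    using normal_equation_solvable[of A] by metis
  define M where "M = transpose (\<chi> j. f (axis j 1))"
  have Mcol: "M *v axis j 1 = f (axis j 1)" for j
    by (simp add: M_def matrix_vector_mult_basis column_transpose row_def vec_eq_iff)
  have "(transpose A ** A ** M) *v axis j 1 = transpose A *v axis j 1" for j
    using f[of "axis j 1"] by (simp add: matrix_vector_mul_assoc [symmetric] Mcol)
  hence "column j (transpose A ** A ** M) = column j (transpose A)" for j
    by (simp only: matrix_vector_mult_basis)
  hence N: "transpose A ** A ** M = transpose A"
    by (simp add: column_def vec_eq_iff)
  have T: "transpose M ** transpose A ** A = A"
    using arg_cong[OF N, of transpose]
    by (simp add: matrix_transpose_mul matrix_mul_assoc)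
  have S: "transpose (A ** M) = A ** M"
    by (metis N T matrix_mul_assoc matrix_transpose_mul)
  have "A ** M ** A = A"
    by (metis S T matrix_transpose_mul)
  with S show ?thesis by blast
qed

lemma ex1_moore_penrose_inverse:
  fixes A :: "real^'n^'m"
  shows "\<exists>!X. is_moore_penrose_inverse A X"
proof -
  obtain M where M1: "A ** M ** A = A" and M3: "transpose (A ** M) = A ** M"
    using ex_13_inverse by blast
  obtain K where K1: "transpose A ** K ** transpose A = transpose A"
    and K3: "transpose (transpose A ** K) = transpose A ** K"
    using ex_13_inverse by blast
  define N where "N = transpose K"
  have N1: "A ** N ** A = A"
    using arg_cong[OF K1, of transpose] by (simp add: N_def matrix_transpose_mul matrix_mul_assoc)
  have N4: "transpose (N ** A) = N ** A"
    using K3 by (simp add: N_def matrix_transpose_mul)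
  define X where "X = N ** A ** M"
  have AX: "A ** X = A ** M" by (simp add: X_def matrix_mul_assoc N1)
  have XA: "X ** A = N ** A" by (metis X_def matrix_mul_assoc M1)
  have XAX: "X ** A ** X = X"
    by (metis XA X_def N1 matrix_mul_assoc)
  have ex: "is_moore_penrose_inverse A X"
    unfolding is_moore_penrose_inverse_def using AX XA XAX M1 M3 N4 by simp
  have "Y = Z" if Y: "is_moore_penrose_inverse A Y" and Z: "is_moore_penrose_inverse A Z" for Y Z
  proof -
    note y = Y[unfolded is_moore_penrose_inverse_def] and z = Z[unfolded is_moore_penrose_inverse_def]
    have "A ** Y = transpose (A ** Y)" using y by simp
    also have "\<dots> = transpose ((A ** Z) ** (A ** Y))" using z by (simp add: matrix_mul_assoc)
    also have "\<dots> = (A ** Y) ** (A ** Z)" using y z by (simp only: matrix_transpose_mul[of "A ** Z"])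
    also have "\<dots> = A ** Z" using y by (simp add: matrix_mul_assoc)
    finally have 1: "A ** Y = A ** Z" .
    have "Y ** A = transpose (Y ** A)" using y by simp
    also have "\<dots> = transpose ((Y ** A) ** (Z ** A))" using z by (metis matrix_mul_assoc)
    also have "\<dots> = (Z ** A) ** (Y ** A)" using y z by (simp only: matrix_transpose_mul[of "Y ** A"])
    also have "\<dots> = Z ** A" using y by (metis matrix_mul_assoc)
    finally have 2: "Y ** A = Z ** A" .
    show ?thesis using 1 2 y z by (metis matrix_mul_assoc)
  qed
  with ex show ?thesis by blast
qed

lemma moore_penrose_inverse:
  "is_moore_penrose_inverse A (moore_penrose_inverse A)"
  unfolding moore_penrose_inverse_def by (rule theI'[OF ex1_moore_penrose_inverse])

end

theory Submission
  imports Defs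
begin

text \<open>For a vector \<open>x\<close>, the entry of \<open>L x\<close> at a maximal coordinate of \<open>x\<close> is non-negative. The rank
  condition gives \<open>L L\<^sup>\<dagger> = I - J / n\<close>, with \<open>J\<close> the all-ones matrix, so \<open>L\<close> maps column \<open>j\<close> of \<open>L\<^sup>\<dagger>\<close>
  to the \<open>j\<close>-th column of \<open>I - J / n\<close>, which is negative off \<open>j\<close>; hence the
  former column is strictly maximal at \<open>j\<close>. The same holds for the rows by transposition, and
  (i) follows from \<open>r\<^sub>i\<^sub>j = (l\<^sup>\<dagger>\<^sub>i\<^sub>i - l\<^sup>\<dagger>\<^sub>i\<^sub>j) + (l\<^sup>\<dagger>\<^sub>j\<^sub>j - l\<^sup>\<dagger>\<^sub>i\<^sub>j)\<close>. The triangle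
  inequality amounts to \<open>l\<^sup>\<dagger>\<^sub>i\<^sub>j - l\<^sup>\<dagger>\<^sub>i\<^sub>k \<le> l\<^sup>\<dagger>\<^sub>j\<^sub>j - l\<^sup>\<dagger>\<^sub>j\<^sub>k\<close>, that is, to the maximality at \<open>j\<close> of the potential
  \<open>L\<^sup>\<dagger> (e\<^sub>j - e\<^sub>k)\<close>, whose image under \<open>L\<close> is non-positive off \<open>j\<close>.\<close>

text \<open>Row \<open>m\<close> of \<open>L\<close> sums to zero, so \<open>x $ m\<close> may be
  subtracted from every coordinate; each remaining term with \<open>k \<noteq> m\<close> is a
  product of two non-positive numbers.\<close>

lemma laplacian_nonneg_at_max:
  fixes L :: "real^'n^'n"
  assumes offdiag: "\<And>i j. i \<noteq> j \<Longrightarrow> L $ i $ j \<le> 0"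
    and row_sums: "L *v 1 = 0"
    and max: "\<And>k. x $ k \<le> x $ m"
  shows "0 \<le> (L *v x) $ m"
proof -
  have "(\<Sum>k\<in>UNIV. L $ m $ k) = (L *v 1) $ m"
    by (simp add: matrix_vector_mult_def)
  hence sum0: "(\<Sum>k\<in>UNIV. L $ m $ k) = 0"
    using row_sums by simp
  have "(L *v x) $ m = (\<Sum>k\<in>UNIV. L $ m $ k * (x $ k - x $ m))"
    by (simp add: matrix_vector_mult_def right_diff_distrib sum_subtractf
        flip: sum_distrib_right) (simp add: sum0)
  also have "\<dots> \<ge> 0"
  proof (rule sum_nonneg)
    fix k show "0 \<le> L $ m $ k * (x $ k - x $ m)"
      using offdiag[of m k] max[of k] by (cases "k = m") (auto intro: mult_nonpos_nonpos)
  qed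
  finally show ?thesis .
qed

lemma strict_maximum_principle:
  fixes L :: "real^'n^'n"
  assumes offdiag: "\<And>i j. i \<noteq> j \<Longrightarrow> L $ i $ j \<le> 0"
    and row_sums: "L *v 1 = 0"
    and neg: "\<And>m. m \<noteq> j \<Longrightarrow> (L *v x) $ m < 0"
    and "i \<noteq> j"
  shows "x $ i < x $ j"
proof -
  \<comment> \<open>A maximum off \<open>j\<close> would contradict \<open>neg\<close>; a tie at
    \<open>i\<close> is excluded in the same way below.\<close>
  have max_at_j: "m = j" if "\<And>k. x $ k \<le> x $ m" for m
    using laplacian_nonneg_at_max[of L x m] offdiag row_sums that neg[of m] by force
  have "Max (range (($) x)) \<in> range (($) x)"
    by (rule Max_in) auto
  then obtain m where "x $ m = Max (range (($) x))" by (metis imageE)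
  hence m: "x $ k \<le> x $ m" for k by simp
  hence "m = j" by (rule max_at_j)
  show ?thesis
  proof (rule ccontr)
    assume "\<not> x $ i < x $ j"
    with m \<open>m = j\<close> have "x $ k \<le> x $ i" for k by (meson not_less order_trans)
    with max_at_j \<open>i \<noteq> j\<close> show False by blast
  qed
qed

text \<open>Perturbing \<open>x\<close> by a small multiple of \<open>u\<close> reduces this to the strict version; this replaces
  a connectivity argument.\<close>

lemma weak_maximum_principle:
  fixes L :: "real^'n^'n"
  assumes offdiag: "\<And>i j. i \<noteq> j \<Longrightarrow> L $ i $ j \<le> 0"
    and row_sums: "L *v 1 = 0"
    and u: "\<And>m. m \<noteq> j \<Longrightarrow> (L *v u) $ m < 0"
    and nonpos: "\<And>m. m \<noteq> j \<Longrightarrow> (L *v x) $ m \<le> 0"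
  shows "x $ i \<le> x $ j"
proof (cases "i = j")
  case False
  have ui: "u $ i < u $ j"
    using strict_maximum_principle[of L j u i] offdiag row_sums u False by blast
  show ?thesis
  proof (rule field_le_epsilon)
    fix e :: real assume "0 < e"
    \<comment> \<open>This \<open>d\<close> makes the perturbation cost exactly \<open>e\<close>
      when \<open>i\<close> is compared with \<open>j\<close>.\<close>
    define d where "d = e / (u $ j - u $ i)"
    have "d > 0" using \<open>0 < e\<close> ui by (simp add: d_def)
    have "(L *v (x + d *\<^sub>R u)) $ m < 0" if "m \<noteq> j" for m
    proof -
      have "(L *v (x + d *\<^sub>R u)) $ m = (L *v x) $ m + d * (L *v u) $ m"
        by (simp add: matrix_vector_right_distrib matrix_vector_mult_scaleR)
      thus ?thesis using u[OF that] nonpos[OF that] \<open>d > 0\<close>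
        by (simp add: add_nonpos_neg mult_pos_neg)
    qed
    hence "(x + d *\<^sub>R u) $ i < (x + d *\<^sub>R u) $ j"
      using strict_maximum_principle[of L j "x + d *\<^sub>R u" i] offdiag row_sums False by blast
    moreover have "d * (u $ j - u $ i) = e" using ui by (simp add: d_def)
    ultimately show "x $ i \<le> x $ j + e" by (simp add: algebra_simps)
  qed
qed simp

lemma is_moore_penrose_inverse_transpose:
  assumes "is_moore_penrose_inverse A X"
  shows "is_moore_penrose_inverse (transpose A) (transpose X)"
  using assms unfolding is_moore_penrose_inverse_def
  by (metis matrix_mul_assoc matrix_transpose_mul)

text \<open>The zero column sums give one inclusion; both subspaces have dimension
  \<open>CARD('n) - 1\<close>.\<close>

lemma range_eq_orthogonal_one:
  fixes L :: "real^'n^'n"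
  assumes col_sums: "transpose L *v 1 = 0"
    and rank: "rank L = CARD('n) - 1"
  shows "range ((*v) L) = {v. inner 1 v = 0}"
proof (rule subspace_dim_equal)
  show "subspace (range ((*v) L))"
    by (simp add: linear_subspace_image)
  show "subspace {v :: real^'n. inner 1 v = 0}" by (rule subspace_hyperplane)
  show "range ((*v) L) \<subseteq> {v. inner 1 v = 0}"
  proof clarify
    fix x
    have "inner 1 (L *v x) = inner (transpose L *v 1) x"
      by (metis dot_lmul_matrix transpose_matrix_vector)
    thus "inner 1 (L *v x) = 0" using col_sums by simp
  qed
  have "(1 :: real^'n) \<noteq> 0" by (simp add: vec_eq_iff)
  hence "dim {v :: real^'n. inner 1 v = 0} = CARD('n) - 1"
    by (simp add: dim_hyperplane)
  thus "dim {v :: real^'n. inner 1 v = 0} \<le> dim (range ((*v) L))"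
    using rank rank_dim_range[of L] by simp
qed

lemma laplacian_mult_moore_penrose_column:
  fixes L :: "real^'n^'n"
  assumes col_sums: "transpose L *v 1 = 0"
    and rank: "rank L = CARD('n) - 1"
    and mp: "is_moore_penrose_inverse L X"
  shows "L *v column j X = axis j 1 - (1 / CARD('n)) *\<^sub>R 1"
proof -
  let ?w = "axis j 1 - (1 / CARD('n)) *\<^sub>R 1 :: real^'n"
  have "inner 1 ?w = 0"
    by (simp add: inner_diff_right inner_axis) (simp add: inner_vec_def)
  then obtain z where z: "?w = L *v z"
    using range_eq_orthogonal_one[OF col_sums rank] by blast
  have "(L ** X) *v 1 = transpose (L ** X) *v 1"
    using mp by (simp add: is_moore_penrose_inverse_def)
  hence ker: "(L ** X) *v 1 = 0"
    by (simp only: matrix_transpose_mul col_sums matrix_vector_mult_0_right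
        flip: matrix_vector_mul_assoc)
  have "L *v column j X = (L ** X) *v axis j 1"
    by (metis matrix_vector_mul_assoc matrix_vector_mult_basis)
  \<comment> \<open>Since \<open>L ** X\<close> kills \<open>1\<close>, \<open>axis j 1\<close> may
    be replaced by its projection \<open>?w\<close>, which lies in the range of \<open>L\<close>,
    where \<open>L ** X\<close> is the identity.\<close>
  also have "\<dots> = (L ** X) *v ?w"
    by (simp add: matrix_vector_mult_diff_distrib matrix_vector_mult_scaleR ker)
  also have "\<dots> = (L ** X ** L) *v z"
    by (simp only: z matrix_vector_mul_assoc)
  also have "\<dots> = ?w"
    using mp z by (simp add: is_moore_penrose_inverse_def)
  finally show ?thesis .
qed

lemma moore_penrose_column_less_diagonal:
  fixes L :: "real^'n^'n"
  assumes offdiag: "\<And>i j. i \<noteq> j \<Longrightarrow> L $ i $ j \<le> 0"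
    and row_sums: "L *v 1 = 0"
    and col_sums: "transpose L *v 1 = 0"
    and rank: "rank L = CARD('n) - 1"
    and mp: "is_moore_penrose_inverse L X"
    and "i \<noteq> j"
  shows "X $ i $ j < X $ j $ j"
proof -
  have "(L *v column j X) $ m < 0" if "m \<noteq> j" for m
    using that
    by (simp add: laplacian_mult_moore_penrose_column[OF col_sums rank mp] axis_def)
  hence "column j X $ i < column j X $ j"
    using strict_maximum_principle[of L j "column j X" i] offdiag row_sums \<open>i \<noteq> j\<close> by blast
  thus ?thesis by (simp add: column_def)
qed

lemma moore_penrose_row_less_diagonal:
  fixes L :: "real^'n^'n"
  assumes offdiag: "\<And>i j. i \<noteq> j \<Longrightarrow> L $ i $ j \<le> 0"
    and row_sums: "L *v 1 = 0"
    and col_sums: "transpose L *v 1 = 0"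
    and rank: "rank L = CARD('n) - 1"
    and mp: "is_moore_penrose_inverse L X"
    and "i \<noteq> j"
  shows "X $ i $ j < X $ i $ i"
proof -
  have "transpose X $ j $ i < transpose X $ i $ i"
  proof (rule moore_penrose_column_less_diagonal)
    show "transpose L $ a $ b \<le> 0" if "a \<noteq> b" for a b
      using offdiag[of b a] that by (simp add: transpose_def)
    show "transpose L *v 1 = 0" by (rule col_sums)
    show "transpose (transpose L) *v 1 = 0" using row_sums by simp
    show "rank (transpose L) = CARD('n) - 1" using rank by (simp add: rank_transpose)
    show "is_moore_penrose_inverse (transpose L) (transpose X)"
      by (rule is_moore_penrose_inverse_transpose[OF mp])
    show "j \<noteq> i" using \<open>i \<noteq> j\<close> by simp
  qed
  thus ?thesis by (simp add: transpose_def)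
qed

lemma moore_penrose_triangle:
  fixes L :: "real^'n^'n"
  assumes offdiag: "\<And>i j. i \<noteq> j \<Longrightarrow> L $ i $ j \<le> 0"
    and row_sums: "L *v 1 = 0"
    and col_sums: "transpose L *v 1 = 0"
    and rank: "rank L = CARD('n) - 1"
    and mp: "is_moore_penrose_inverse L X"
  shows "X $ i $ j + X $ j $ k \<le> X $ j $ j + X $ i $ k"
proof -
  note col = laplacian_mult_moore_penrose_column[OF col_sums rank mp]
  have "(column j X - column k X) $ i \<le> (column j X - column k X) $ j"
  proof (rule weak_maximum_principle[of L])
    \<comment> \<open>Column \<open>j\<close> itself serves as the perturbation \<open>u\<close>:
      its image is \<open>-1/n\<close> off \<open>j\<close>.\<close>
    show "(L *v column j X) $ m < 0" if "m \<noteq> j" for m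
      using that by (simp add: col axis_def)
    \<comment> \<open>The \<open>1/n\<close> terms cancel, leaving
      \<open>axis j 1 - axis k 1\<close>.\<close>
    show "(L *v (column j X - column k X)) $ m \<le> 0" if "m \<noteq> j" for m
      using that by (simp add: matrix_vector_mult_diff_distrib col axis_def)
  qed (use offdiag row_sums in auto)
  thus ?thesis by (simp add: column_def)
qed

theorem theorem3p2:
  fixes L :: "real^'n^'n"
  assumes offdiag: "\<And>i j. i \<noteq> j \<Longrightarrow> L $ i $ j \<le> 0"
    and row_sums: "L *v 1 = 0"
    and col_sums: "transpose L *v 1 = 0"
    and rank: "rank L = CARD('n) - 1"
  shows "(\<forall>i j. i \<noteq> j \<longrightarrow> resistance L i j > 0)
    \<and> (\<forall>i j k. resistance L i k \<le> resistance L i j + resistance L j k)"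
proof (intro conjI allI impI)
  note mp = moore_penrose_inverse[of L]
  show "resistance L i j > 0" if "i \<noteq> j" for i j
    using moore_penrose_column_less_diagonal[OF offdiag row_sums col_sums rank mp that]
      moore_penrose_row_less_diagonal[OF offdiag row_sums col_sums rank mp that]
    by (simp add: resistance_def)
  \<comment> \<open>The diagonal entries at \<open>i\<close> and \<open>k\<close> cancel, leaving
    twice the inequality of \<open>moore_penrose_triangle\<close>.\<close>
  show "resistance L i k \<le> resistance L i j + resistance L j k" for i j k
    using moore_penrose_triangle[OF offdiag row_sums col_sums rank mp, of i j k]
    by (simp add: resistance_def)
qed

end
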